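(* For all integers $t \ge 3$ and all positive integers $n$, \[ \eta(K_t^n) = \eta(K_t) = \frac{\log t}{\log t - \log (t-1)}, \] and moreover $\frac{\log t}{\log t - \log (t-1)} = t \log t + \Theta(\log t)$ as $t \to \infty$.
   Context: For an integer $t\ge 3$ and $n \ge 1$, $K_t^n$ denotes the $n$-th tensor power of the complete graph $K_t$: its vertex set is $[t]^n = \{1,\dots,t\}^n$, and $x,y \in [t]^n$ are adjacent iff $x_i \neq y_i$ for all $i \in [n]$. For a finite graph $G=(V_G,E_G)$ and $S \subseteq V_G$, the vertex boundary is $\partial S := \{x \in V_G : \exists y \in S \text{ with } \{x,y\} \in E_G\}$ (it may contain points of $S$), and the density is $\mu(S) := |S|/|V_G|$. For $\epsilon>0$, $\eta(G,\epsilon) := \inf\{ \log \mu(S)/\log \mu(\partial S) : S \subset V_G,\ \mu(\partial S) \in (0,\epsilon)\}$, and $\eta(G) := \eta(G,1)$. Here $\log$ is the natural logarithm. *)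

theory Defs
  imports Complex_Main "HOL-Library.FuncSet" "HOL-Library.Extended_Real" "HOL-Library.Landau_Symbols"
begin

record 'a ugraph =
  verts :: "'a set"
  edges :: "'a set set"

definition complete_graph :: "nat \<Rightarrow> nat ugraph" where
  "complete_graph t =
     \<lparr>verts = {1..t}, edges = {{x, y} | x y. x \<in> {1..t} \<and> y \<in> {1..t} \<and> x \<noteq> y}\<rparr>"

text \<open>The points of $[t]^n$ are the extensional functions from \<open>{1..n}\<close> to \<open>{1..t}\<close>.\<close>

definition complete_tensor_power :: "nat \<Rightarrow> nat \<Rightarrow> (nat \<Rightarrow> nat) ugraph" where
  "complete_tensor_power t n =
     \<lparr>verts = {1..n} \<rightarrow>\<^sub>E {1..t},
      edges = {{x, y} | x y. x \<in> {1..n} \<rightarrow>\<^sub>E {1..t} \<and> y \<in> {1..n} \<rightarrow>\<^sub>E {1..t} \<and>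
                 (\<forall>i\<in>{1..n}. x i \<noteq> y i)}\<rparr>"

definition vertex_boundary :: "'a ugraph \<Rightarrow> 'a set \<Rightarrow> 'a set" where
  "vertex_boundary G S = {x \<in> verts G. \<exists>y\<in>S. {x, y} \<in> edges G}"

definition vertex_density :: "'a ugraph \<Rightarrow> 'a set \<Rightarrow> real" where
  "vertex_density G S = real (card S) / real (card (verts G))"

text \<open>The infimum is taken in the extended reals, so that it is \<open>\<infinity>\<close> if no set \<open>S\<close> is admissible.\<close>

definition eta_below :: "'a ugraph \<Rightarrow> real \<Rightarrow> ereal" where
  "eta_below G \<epsilon> =
     Inf {ereal (ln (vertex_density G S) / ln (vertex_density G (vertex_boundary G S))) | S.
            S \<subseteq> verts G \<and> vertex_density G (vertex_boundary G S) \<in> {0<..<\<epsilon>}}"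

definition eta :: "'a ugraph \<Rightarrow> ereal" where
  "eta G = eta_below G 1"

end

theory Submission
  imports Defs "HOL-Analysis.Convex" "HOL-Real_Asymp.Real_Asymp"
begin

text \<open>Put \<open>p = (ln t - ln (t - 1)) / ln t\<close>, so that \<open>(1 / t) powr p = 1 - 1 / t\<close>. The claim
  is that \<open>\<mu> S powr p \<le> \<mu> (\<partial> S)\<close>, with equality when \<open>S\<close> fixes one coordinate. It is proved by
  induction on the number of coordinates. Slice \<open>S\<close> along one coordinate into \<open>S a\<close> for
  \<open>a \<in> {1..t}\<close>; the slice of \<open>\<partial> S\<close> at \<open>b\<close> contains \<open>\<partial> (S a)\<close> for every \<open>a \<noteq> b\<close>. If \<open>x \<ge> y\<close> are
  the two largest densities of the slices, the induction step therefore reduces to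
  \<open>((x + (t - 1) * y) / t) powr p \<le> ((t - 1) * x powr p + y powr p) / t\<close>, which follows from
  concavity since both sides agree at \<open>y = 0\<close> and at \<open>y = x\<close>.\<close>

section \<open>Concavity inequalities for real powers\<close>

text \<open>Jensen's inequality for the points \<open>1\<close> and \<open>c\<close>: after division
  by their mean \<open>M\<close>, the tangent bound at 1, which is Young's inequality with second
  factor 1, averages to exactly 1.\<close>

lemma powr_two_point_concave:
  fixes \<alpha> \<beta> c p :: real
  assumes "0 \<le> \<alpha>" "0 \<le> \<beta>" "\<alpha> + \<beta> = 1" "0 < c" "0 \<le> p" "p \<le> 1"
  shows "\<alpha> + \<beta> * c powr p \<le> (\<alpha> + \<beta> * c) powr p"
proof -
  define M where "M = \<alpha> + \<beta> * c"
  have M: "M > 0"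
  proof (cases "\<beta> = 0")
    case True
    then show ?thesis using assms by (simp add: M_def)
  next
    case False
    then have "\<beta> * c > 0" using assms by simp
    then show ?thesis using assms by (simp add: M_def)
  qed
  have bern: "y powr p \<le> p * y + (1 - p)" if "y > 0" for y :: real
    using Youngs_inequality_0[of p "1 - p" y 1] assms that by simp
  have "\<alpha> * (1 / M) powr p + \<beta> * (c / M) powr p
        \<le> \<alpha> * (p * (1 / M) + (1 - p)) + \<beta> * (p * (c / M) + (1 - p))"
    using bern[of "1 / M"] bern[of "c / M"] M assms by (intro add_mono mult_left_mono) auto
  also have "\<dots> = p * ((\<alpha> + \<beta> * c) / M) + (1 - p) * (\<alpha> + \<beta>)"
    by (simp add: algebra_simps add_divide_distrib)
  also have "\<dots> = 1"
    using M assms by (simp flip: M_def)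
  finally have "(\<alpha> + \<beta> * c powr p) / M powr p \<le> 1"
    using M assms by (simp add: powr_divide add_divide_distrib)
  then show ?thesis
    using M by (simp add: M_def)
qed

text \<open>After normalising, this compares the function
  \<open>x \<mapsto> (A + B * x powr p) powr (1 / p)\<close>, which is concave by the reverse Minkowski inequality,
  with its chord.\<close>

lemma two_value_inequality:
  fixes t p x y :: real
  assumes t: "t > 1" and p: "0 < p" "p \<le> 1" and tp: "(1 / t) powr p = 1 - 1 / t"
    and y: "0 \<le> y" and yx: "y \<le> x"
  shows "((x + (t - 1) * y) / t) powr p \<le> ((t - 1) * x powr p + y powr p) / t"
proof (cases "y = 0")
  case True
  have "(x * (1 / t)) powr p = x powr p * (1 - 1 / t)"
    using t tp y yx by (subst powr_mult) auto
  then show ?thesis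
    using True t p by (simp add: field_simps)
next
  case False
  then have y0: "y > 0" and x0: "x > 0" using y yx by auto
  define W where "W = x + (t - 1) * y"
  have W: "W > 0" using x0 y0 t by (simp add: W_def add_pos_nonneg)
  \<comment> \<open>The normalised pair \<open>(x / W, y / W)\<close> is the convex combination,
    with weights \<open>\<alpha>\<close> and \<open>\<beta>\<close>, of \<open>(1, 0)\<close> and
    \<open>(1 / t, 1 / t)\<close>, the two cases of equality.\<close>
  define \<alpha> \<beta> where "\<alpha> = (x - y) / W" and "\<beta> = t * y / W"
  have ab: "\<alpha> \<ge> 0" "\<beta> > 0" "\<alpha> + \<beta> = 1"
    using W yx y0 t by (auto simp: \<alpha>_def \<beta>_def W_def simp flip: add_divide_distrib)
       (simp add: algebra_simps)
  have xW: "x / W = \<alpha> + \<beta> * (1 / t)"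
    using W t by (simp add: \<alpha>_def \<beta>_def flip: add_divide_distrib)
  have yW: "y / W = \<beta> * (1 / t)"
    using W t by (simp add: \<beta>_def)
  have 1: "\<alpha> + \<beta> * (1 - 1 / t) \<le> (x / W) powr p"
    using powr_two_point_concave[of \<alpha> \<beta> "1 / t" p] ab t p tp by (simp add: xW)
  have "\<beta> powr 1 \<le> \<beta> powr p"
    using ab p by (intro powr_mono') auto
  then have "\<beta> * (1 - 1 / t) \<le> \<beta> powr p * (1 / t) powr p"
    unfolding tp using ab t by (intro mult_right_mono) auto
  then have 2: "\<beta> * (1 - 1 / t) \<le> (y / W) powr p"
    unfolding yW using ab t by (subst powr_mult) auto
  \<comment> \<open>The lower bounds \<open>1\<close> and \<open>2\<close> are linear in
    \<open>\<alpha>\<close> and \<open>\<beta>\<close>; with weights \<open>1 - 1 / t\<close> and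
    \<open>1 / t\<close> they add up to \<open>1 - 1 / t\<close>, which is
    \<open>(1 / t) powr p\<close>.\<close>
  have "(1 - 1 / t) * (\<alpha> + \<beta> * (1 - 1 / t)) + (\<beta> * (1 - 1 / t)) / t
        \<le> (1 - 1 / t) * (x / W) powr p + (y / W) powr p / t"
    using 1 2 t by (intro add_mono mult_left_mono divide_right_mono) auto
  also have "(1 - 1 / t) * (\<alpha> + \<beta> * (1 - 1 / t)) + (\<beta> * (1 - 1 / t)) / t
        = (1 - 1 / t) * (\<alpha> + \<beta>)"
    by (simp add: algebra_simps diff_divide_distrib)
  finally have "1 - 1 / t \<le> ((1 - 1 / t) * x powr p + y powr p / t) / W powr p"
    using ab x0 y0 W by (simp add: powr_divide add_divide_distrib mult.commute)
  then have "W powr p * (1 / t) powr p \<le> (1 - 1 / t) * x powr p + y powr p / t"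
    using W tp by (simp add: pos_le_divide_eq mult.commute)
  moreover have "W powr p * (1 / t) powr p = (W / t) powr p"
    using W t by (simp flip: powr_mult)
  ultimately show ?thesis
    using t by (simp add: W_def field_simps)
qed

section \<open>The exponent and the averaging over one coordinate\<close>

definition clique_exponent :: "nat \<Rightarrow> real" where
  "clique_exponent t = (ln (real t) - ln (real t - 1)) / ln (real t)"

lemma
  assumes "t \<ge> 3"
  shows clique_exponent_pos: "0 < clique_exponent t"
    and clique_exponent_less_1: "clique_exponent t < 1"
    and powr_clique_exponent: "(1 / real t) powr clique_exponent t = 1 - 1 / real t"
proof -
  have ln: "0 < ln (real t - 1)" "ln (real t - 1) < ln (real t)"
    using assms by auto
  show "0 < clique_exponent t" "clique_exponent t < 1"
    using ln by (auto simp: clique_exponent_def field_simps)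
  have "(1 / real t) powr clique_exponent t = exp (ln (real t - 1) - ln (real t))"
    using ln assms by (simp add: clique_exponent_def powr_def ln_div field_simps)
  also have "\<dots> = 1 - 1 / real t"
    using assms by (simp add: exp_diff field_simps)
  finally show "(1 / real t) powr clique_exponent t = 1 - 1 / real t" .
qed

text \<open>This is the induction step in numerical form: \<open>u\<close> and \<open>v\<close>
  stand for the slice densities of a set and of its boundary. Indicator functions for
  \<open>u\<close> and \<open>v\<close> give the single clique.\<close>

lemma clique_averaging_inequality:
  fixes u v :: "nat \<Rightarrow> real"
  assumes t: "t \<ge> 3"
    and u: "\<And>a. a \<in> {1..t} \<Longrightarrow> 0 \<le> u a"
    and v: "\<And>a b. a \<in> {1..t} \<Longrightarrow> b \<in> {1..t} \<Longrightarrow> a \<noteq> b \<Longrightarrow> u a powr clique_exponent t \<le> v b"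
  shows "((\<Sum>a\<in>{1..t}. u a) / t) powr clique_exponent t \<le> (\<Sum>b\<in>{1..t}. v b) / t"
proof -
  define p where "p = clique_exponent t"
  have max: "\<exists>m\<in>A. \<forall>a\<in>A. u a \<le> u m" if "finite A" "A \<noteq> {}" for A
  proof -
    have "Max (u ` A) \<in> u ` A" using that by simp
    then obtain m where "m \<in> A" "u m = Max (u ` A)" by auto
    then show ?thesis using that by (metis Max_ge finite_imageI imageI)
  qed
  obtain m where m: "m \<in> {1..t}" "\<And>a. a \<in> {1..t} \<Longrightarrow> u a \<le> u m"
    using t max[of "{1..t}"] by auto
  have card: "card ({1..t} - {m}) = t - 1" using m by simp
  moreover have "t - 1 \<noteq> 0" using t by simp
  ultimately have "{1..t} - {m} \<noteq> {}" by (metis card.empty)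
  then obtain k where k: "k \<in> {1..t} - {m}" "\<And>a. a \<in> {1..t} - {m} \<Longrightarrow> u a \<le> u k"
    using max[of "{1..t} - {m}"] by blast
  have t1: "real (t - 1) = real t - 1" using t by simp
  have "(\<Sum>a\<in>{1..t}. u a) = u m + (\<Sum>a\<in>{1..t} - {m}. u a)"
    using m by (simp add: sum.remove)
  also have "\<dots> \<le> u m + (\<Sum>a\<in>{1..t} - {m}. u k)"
    using k by (intro add_left_mono sum_mono) auto
  finally have su: "(\<Sum>a\<in>{1..t}. u a) \<le> u m + (real t - 1) * u k"
    using card t1 by simp
  have "(real t - 1) * u m powr p + u k powr p
        = u k powr p + (\<Sum>b\<in>{1..t} - {m}. u m powr p)"
    using card t1 by simp
  \<comment> \<open>Every \<open>b\<close> other than \<open>m\<close> may be compared with the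
    maximiser \<open>m\<close>; \<open>m\<close> itself must be compared with another index, and the
    best one is the runner-up \<open>k\<close>.\<close>
  also have "\<dots> \<le> v m + (\<Sum>b\<in>{1..t} - {m}. v b)"
    unfolding p_def using v m k by (intro add_mono sum_mono) auto
  also have "\<dots> = (\<Sum>b\<in>{1..t}. v b)"
    using m by (simp add: sum.remove)
  finally have sv: "(real t - 1) * u m powr p + u k powr p \<le> (\<Sum>b\<in>{1..t}. v b)" .
  have "((\<Sum>a\<in>{1..t}. u a) / t) powr p \<le> ((u m + (real t - 1) * u k) / t) powr p"
    using su t u clique_exponent_pos[OF t]
    by (intro powr_mono2 divide_right_mono divide_nonneg_nonneg sum_nonneg) (auto simp: p_def)
  also have "\<dots> \<le> ((real t - 1) * u m powr p + u k powr p) / t"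
    using t m k u clique_exponent_pos[OF t] clique_exponent_less_1[OF t] powr_clique_exponent[OF t]
    by (intro two_value_inequality) (auto simp: p_def)
  also have "\<dots> \<le> (\<Sum>b\<in>{1..t}. v b) / t"
    using sv by (intro divide_right_mono) auto
  finally show ?thesis by (simp add: p_def)
qed

section \<open>Isoperimetry in tensor powers, by slicing\<close>

text \<open>An arbitrary index set in place of \<open>{1..n}\<close> lets the induction add one
  coordinate at a time.\<close>

definition tensor_boundary :: "nat \<Rightarrow> 'i set \<Rightarrow> ('i \<Rightarrow> nat) set \<Rightarrow> ('i \<Rightarrow> nat) set" where
  "tensor_boundary t I S = {x \<in> I \<rightarrow>\<^sub>E {1..t}. \<exists>y\<in>S. \<forall>i\<in>I. x i \<noteq> y i}"

definition slice :: "nat \<Rightarrow> 'i set \<Rightarrow> 'i \<Rightarrow> nat \<Rightarrow> ('i \<Rightarrow> nat) set \<Rightarrow> ('i \<Rightarrow> nat) set" where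
  "slice t I i a S = {f \<in> I \<rightarrow>\<^sub>E {1..t}. f(i := a) \<in> S}"

lemma finite_slice: "finite I \<Longrightarrow> finite (slice t I i a S)"
  by (simp add: slice_def finite_PiE)

lemma card_eq_sum_slices:
  assumes "finite I" "i \<notin> I" "S \<subseteq> insert i I \<rightarrow>\<^sub>E {1..t}"
  shows "card S = (\<Sum>a\<in>{1..t}. card (slice t I i a S))"
proof -
  let ?g = "\<lambda>(a, f). f(i := a)"
  have "S = ?g ` (SIGMA a:{1..t}. slice t I i a S)"
    using assms(3) by (fastforce simp: slice_def PiE_insert_eq image_iff)
  moreover have "inj_on ?g (SIGMA a:{1..t}. slice t I i a S)"
    using inj_combinator[OF assms(2), of "\<lambda>_. {1..t}"]
    by (rule inj_on_subset) (auto simp: slice_def)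
  ultimately have "card S = card (SIGMA a:{1..t}. slice t I i a S)"
    by (metis card_image)
  then show ?thesis
    using assms(1) by (simp add: finite_slice)
qed

text \<open>If \<open>y\<close> witnesses that \<open>x\<close> lies in the boundary of the slice,
  then \<open>y(i := a)\<close> does so for \<open>x(i := b)\<close>: the new coordinate only
  demands \<open>a \<noteq> b\<close>.\<close>

lemma tensor_boundary_slice_subset:
  assumes "i \<notin> I" "b \<in> {1..t}" "a \<noteq> b"
  shows "tensor_boundary t I (slice t I i a S) \<subseteq> slice t I i b (tensor_boundary t (insert i I) S)"
proof
  fix x assume "x \<in> tensor_boundary t I (slice t I i a S)"
  then obtain y where x: "x \<in> I \<rightarrow>\<^sub>E {1..t}" and y: "y(i := a) \<in> S" "\<forall>j\<in>I. x j \<noteq> y j"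
    by (auto simp: tensor_boundary_def slice_def)
  have "\<forall>j\<in>insert i I. (x(i := b)) j \<noteq> (y(i := a)) j"
    using y assms by auto
  moreover have "x(i := b) \<in> insert i I \<rightarrow>\<^sub>E {1..t}"
    using x assms by (auto simp: PiE_insert_eq image_iff)
  ultimately show "x \<in> slice t I i b (tensor_boundary t (insert i I) S)"
    using x y unfolding tensor_boundary_def slice_def by blast
qed

lemma tensor_boundary_isoperimetry:
  assumes t: "t \<ge> 3" and "finite I" and "S \<subseteq> I \<rightarrow>\<^sub>E {1..t}"
  shows "(card S / real t ^ card I) powr clique_exponent t \<le> card (tensor_boundary t I S) / real t ^ card I"
  using assms(2,3)
proof (induction I arbitrary: S rule: finite_induct)
  case empty
  \<comment> \<open>Without coordinates there is a single point, which is vacuously adjacent to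
    itself; the density is 0 or 1, and both are fixed by the power.\<close>
  then have "tensor_boundary t {} S = S" "S = {} \<or> S = {\<lambda>_. undefined}"
    by (auto simp: tensor_boundary_def)
  then show ?case
    using clique_exponent_pos[OF t] by auto
next
  case (insert i I)
  let ?T = "tensor_boundary t (insert i I) S"
  define u v where "u = (\<lambda>a. card (slice t I i a S) / real t ^ card I)"
    and "v = (\<lambda>b. card (slice t I i b ?T) / real t ^ card I)"
  have T: "?T \<subseteq> insert i I \<rightarrow>\<^sub>E {1..t}"
    by (auto simp: tensor_boundary_def)
  have uv: "u a powr clique_exponent t \<le> v b" if "b \<in> {1..t}" "a \<noteq> b" for a b
  proof -
    have "u a powr clique_exponent t
          \<le> card (tensor_boundary t I (slice t I i a S)) / real t ^ card I"
      unfolding u_def by (rule insert.IH) (auto simp: slice_def)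
    also have "card (tensor_boundary t I (slice t I i a S)) \<le> card (slice t I i b ?T)"
      by (intro card_mono finite_slice tensor_boundary_slice_subset insert.hyps that)
    finally show ?thesis
      by (simp add: v_def divide_right_mono)
  qed
  have "((\<Sum>a\<in>{1..t}. u a) / t) powr clique_exponent t \<le> (\<Sum>b\<in>{1..t}. v b) / t"
    using uv by (intro clique_averaging_inequality t) (auto simp: u_def)
  moreover have "(\<Sum>a\<in>{1..t}. u a) / t = card S / real t ^ card (insert i I)"
    using card_eq_sum_slices[OF insert.hyps insert.prems] insert.hyps
    by (simp add: u_def flip: sum_divide_distrib)
  moreover have "(\<Sum>b\<in>{1..t}. v b) / t = card ?T / real t ^ card (insert i I)"
    using card_eq_sum_slices[OF insert.hyps T] insert.hyps
    by (simp add: v_def flip: sum_divide_distrib)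
  ultimately show ?case by simp
qed

section \<open>From isoperimetry to the values of \<open>eta\<close>\<close>

lemma vertex_boundary_complete_tensor_power:
  assumes "S \<subseteq> verts (complete_tensor_power t n)"
  shows "vertex_boundary (complete_tensor_power t n) S = tensor_boundary t {1..n} S"
proof -
  have "{x, y} \<in> edges (complete_tensor_power t n) \<longleftrightarrow> (\<forall>i\<in>{1..n}. x i \<noteq> y i)"
    if "x \<in> {1..n} \<rightarrow>\<^sub>E {1..t}" "y \<in> {1..n} \<rightarrow>\<^sub>E {1..t}" for x y
    using that unfolding complete_tensor_power_def
    by (simp add: doubleton_eq_iff) metis
  moreover have "verts (complete_tensor_power t n) = {1..n} \<rightarrow>\<^sub>E {1..t}"
    by (simp add: complete_tensor_power_def)
  ultimately show ?thesis
    using assms unfolding vertex_boundary_def tensor_boundary_def by blast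
qed

lemma vertex_boundary_complete_graph:
  assumes "S \<subseteq> verts (complete_graph t)"
  shows "vertex_boundary (complete_graph t) S = {x \<in> {1..t}. \<exists>y\<in>S. x \<noteq> y}"
proof -
  have "{x, y} \<in> edges (complete_graph t) \<longleftrightarrow> x \<noteq> y" if "x \<in> {1..t}" "y \<in> {1..t}" for x y
    using that by (auto simp: complete_graph_def doubleton_eq_iff)
  moreover have "verts (complete_graph t) = {1..t}"
    by (simp add: complete_graph_def)
  ultimately show ?thesis
    using assms unfolding vertex_boundary_def by blast
qed

text \<open>The claimed value is \<open>1 / clique_exponent t\<close>. Taking logarithms in
  \<open>iso\<close> bounds every admissible ratio below by it, the sign of \<open>ln ?m\<close>
  reversing the inequality; \<open>S0\<close> attains it.\<close>

lemma eta_eqI: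
  assumes fin: "finite (verts G)" and t: "t \<ge> 3"
    and iso: "\<And>S. S \<subseteq> verts G \<Longrightarrow>
      vertex_density G S powr clique_exponent t \<le> vertex_density G (vertex_boundary G S)"
    and S0: "S0 \<subseteq> verts G" "vertex_density G S0 = 1 / real t"
      "vertex_density G (vertex_boundary G S0) = 1 - 1 / real t"
  shows "eta G = ereal (ln (real t) / (ln (real t) - ln (real t - 1)))"
  unfolding eta_def eta_below_def
proof (rule antisym[OF Inf_lower Inf_greatest])
  have "ln (1 - 1 / real t) = ln ((real t - 1) / real t)"
    using t by (simp add: field_simps)
  also have "\<dots> = ln (real t - 1) - ln (real t)"
    using t by (simp add: ln_div)
  finally have "ln (vertex_density G S0) / ln (vertex_density G (vertex_boundary G S0))
      = ln (real t) / (ln (real t) - ln (real t - 1))"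
    using t by (simp add: S0 ln_div minus_divide_right)
  moreover have "vertex_density G (vertex_boundary G S0) \<in> {0<..<1}"
    using t by (simp add: S0)
  ultimately show "ereal (ln (real t) / (ln (real t) - ln (real t - 1)))
    \<in> {ereal (ln (vertex_density G S) / ln (vertex_density G (vertex_boundary G S))) | S.
            S \<subseteq> verts G \<and> vertex_density G (vertex_boundary G S) \<in> {0<..<1}}"
    using S0(1) by (intro CollectI exI[of _ S0] conjI) simp_all
next
  fix e
  assume "e \<in> {ereal (ln (vertex_density G S) / ln (vertex_density G (vertex_boundary G S))) | S.
            S \<subseteq> verts G \<and> vertex_density G (vertex_boundary G S) \<in> {0<..<1}}"
  then obtain S where S: "S \<subseteq> verts G"
    and m: "0 < vertex_density G (vertex_boundary G S)" "vertex_density G (vertex_boundary G S) < 1"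
    and e: "e = ereal (ln (vertex_density G S) / ln (vertex_density G (vertex_boundary G S)))"
    by auto
  let ?m = "vertex_density G (vertex_boundary G S)" and ?p = "clique_exponent t"
  \<comment> \<open>An empty \<open>S\<close> would have an empty boundary, against the positive
    density in \<open>m\<close>.\<close>
  have "S \<noteq> {}"
    using m by (auto simp: vertex_density_def vertex_boundary_def)
  then have "vertex_density G S > 0"
    using finite_subset[OF S fin] S fin
    by (auto simp: vertex_density_def card_gt_0_iff intro!: divide_pos_pos)
  moreover from this have "ln (vertex_density G S powr ?p) \<le> ln ?m"
    using iso[OF S] by (intro ln_mono) auto
  ultimately have "?p * ln (vertex_density G S) \<le> ln ?m"
    by (simp add: ln_powr)
  moreover have "ln ?m < 0" using m by simp
  ultimately have "1 / ?p \<le> ln (vertex_density G S) / ln ?m"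
    using clique_exponent_pos[OF t] by (simp add: field_simps)
  then show "ereal (ln (real t) / (ln (real t) - ln (real t - 1))) \<le> e"
    by (simp add: e clique_exponent_def)
qed

lemma eta_complete_graph:
  assumes t: "t \<ge> 3"
  shows "eta (complete_graph t) = ereal (ln (real t) / (ln (real t) - ln (real t - 1)))"
proof (rule eta_eqI[OF _ t])
  let ?G = "complete_graph t"
  have V: "verts ?G = {1..t}" by (simp add: complete_graph_def)
  show "finite (verts ?G)" by (simp add: V)
  show "vertex_density ?G S powr clique_exponent t \<le> vertex_density ?G (vertex_boundary ?G S)"
    if S: "S \<subseteq> verts ?G" for S
  proof -
    let ?T = "vertex_boundary ?G S"
    have T: "?T = {x \<in> {1..t}. \<exists>y\<in>S. x \<noteq> y}"
      by (rule vertex_boundary_complete_graph[OF S])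
    \<comment> \<open>Each vertex acts as a slice of density 0 or 1, so averaging the indicators
      gives the densities of \<open>S\<close> and \<open>?T\<close>.\<close>
    have "((\<Sum>a\<in>{1..t}. of_bool (a \<in> S)) / t) powr clique_exponent t \<le> (\<Sum>b\<in>{1..t}. of_bool (b \<in> ?T)) / t"
    proof (intro clique_averaging_inequality t)
      show "of_bool (a \<in> S) powr clique_exponent t \<le> (of_bool (b \<in> ?T) :: real)"
        if "a \<in> {1..t}" "b \<in> {1..t}" "a \<noteq> b" for a b
        using that by (cases "a \<in> S") (auto simp: T)
    qed simp
    moreover have "(\<Sum>a\<in>{1..t}. of_bool (a \<in> A)) = real (card A)" if "A \<subseteq> {1..t}" for A
      using that by (simp add: Int_absorb1)
    moreover have "?T \<subseteq> {1..t}" by (auto simp: T)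
    ultimately show ?thesis
      using S unfolding vertex_density_def V by simp
  qed
  show S0: "{1} \<subseteq> verts ?G" using t by (simp add: V)
  show "vertex_density ?G {1} = 1 / real t" by (simp add: vertex_density_def V)
  have "vertex_boundary ?G {1} = {1..t} - {1}"
    by (subst vertex_boundary_complete_graph[OF S0]) auto
  then show "vertex_density ?G (vertex_boundary ?G {1}) = 1 - 1 / real t"
    using t by (simp add: vertex_density_def V field_simps)
qed

text \<open>The extra factor \<open>t\<close> avoids the truncated exponent
  \<open>card I - 1\<close>.\<close>

lemma card_cylinder:
  assumes "finite I" "i \<in> I" "A \<subseteq> {1..t}"
  shows "card {x \<in> I \<rightarrow>\<^sub>E {1..t}. x i \<in> A} * t = card A * t ^ card I"
proof -
  have "(\<forall>j\<in>I. x j \<in> {1..t}) \<and> x i \<in> A \<longleftrightarrow> (\<forall>j\<in>I. x j \<in> (if j = i then A else {1..t}))" for x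
    using assms(2,3) by (metis subsetD)
  then have "{x \<in> I \<rightarrow>\<^sub>E {1..t}. x i \<in> A} = (\<Pi>\<^sub>E j\<in>I. if j = i then A else {1..t})"
    unfolding PiE_iff set_eq_iff mem_Collect_eq by blast
  then have "card {x \<in> I \<rightarrow>\<^sub>E {1..t}. x i \<in> A} = (\<Prod>j\<in>I. if j = i then card A else t)"
    using assms(1) by (simp add: card_PiE if_distrib cong: if_cong)
  also have "\<dots> = card A * t ^ (card I - 1)"
    using assms by (simp add: prod.remove[of I i])
  finally show ?thesis
    using assms by (metis card_gt_0_iff empty_iff mult.assoc power_minus_mult)
qed

lemma eta_complete_tensor_power:
  assumes t: "t \<ge> 3" and n: "n \<ge> 1"
  shows "eta (complete_tensor_power t n) = ereal (ln (real t) / (ln (real t) - ln (real t - 1)))"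
proof (rule eta_eqI[OF _ t])
  let ?G = "complete_tensor_power t n"
  \<comment> \<open>The extremal set fixes one coordinate; writing this as membership in
    \<open>{1}\<close> makes it an instance of \<open>dens\<close>.\<close>
  let ?S = "{x \<in> {1..n} \<rightarrow>\<^sub>E {1..t}. x 1 \<in> {1}}"
  have V: "verts ?G = {1..n} \<rightarrow>\<^sub>E {1..t}" by (simp add: complete_tensor_power_def)
  have cV: "card (verts ?G) = t ^ n" by (simp add: V card_PiE)
  show "finite (verts ?G)" by (simp add: V finite_PiE)
  show "vertex_density ?G S powr clique_exponent t \<le> vertex_density ?G (vertex_boundary ?G S)"
    if S: "S \<subseteq> verts ?G" for S
    using tensor_boundary_isoperimetry[OF t, of "{1..n}" S] S V
    unfolding vertex_density_def cV vertex_boundary_complete_tensor_power[OF S] by simp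
  show S0: "?S \<subseteq> verts ?G" by (auto simp: V)
  have dens: "vertex_density ?G {x \<in> {1..n} \<rightarrow>\<^sub>E {1..t}. x 1 \<in> A} = card A / t" if "A \<subseteq> {1..t}" for A
  proof -
    have "real (card {x \<in> {1..n} \<rightarrow>\<^sub>E {1..t}. x 1 \<in> A} * t) = real (card A * t ^ n)"
      using card_cylinder[of "{1..n}" 1 A t] n that by simp
    then show ?thesis
      using t by (simp add: vertex_density_def cV field_simps)
  qed
  show "vertex_density ?G ?S = 1 / real t"
    using dens[of "{1}"] t by simp
  have "vertex_boundary ?G ?S = {x \<in> {1..n} \<rightarrow>\<^sub>E {1..t}. x 1 \<in> {1..t} - {1}}"
  proof (subst vertex_boundary_complete_tensor_power[OF S0], intro equalityI subsetI)
    fix x assume "x \<in> tensor_boundary t {1..n} ?S"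
    then show "x \<in> {x \<in> {1..n} \<rightarrow>\<^sub>E {1..t}. x 1 \<in> {1..t} - {1}}"
      using n by (fastforce simp: tensor_boundary_def)
  next
    fix x assume x: "x \<in> {x \<in> {1..n} \<rightarrow>\<^sub>E {1..t}. x 1 \<in> {1..t} - {1}}"
    \<comment> \<open>At every coordinate \<open>y\<close> takes a value in \<open>{1, 2}\<close>
      that differs from \<open>x\<close>; since \<open>x 1 \<noteq> 1\<close>, its first value is 1,
      as \<open>?S\<close> requires.\<close>
    define y where "y = (\<lambda>i\<in>{1..n}. if x i = 1 then 2 else 1 :: nat)"
    have "y \<in> ?S" "\<forall>i\<in>{1..n}. x i \<noteq> y i"
      using x t n by (auto simp: y_def)
    then show "x \<in> tensor_boundary t {1..n} ?S"
      using x unfolding tensor_boundary_def by blast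
  qed
  then show "vertex_density ?G (vertex_boundary ?G ?S) = 1 - 1 / real t"
    using dens[of "{1..t} - {1}"] t by (simp add: field_simps)
qed

theorem theorem1p1:
  shows "(\<forall>t\<ge>3. \<forall>n\<ge>1.
            eta (complete_tensor_power t n) = eta (complete_graph t) \<and>
            eta (complete_graph t) = ereal (ln (real t) / (ln (real t) - ln (real t - 1)))) \<and>
         (\<lambda>t::nat. ln (real t) / (ln (real t) - ln (real t - 1)) - real t * ln (real t))
           \<in> \<Theta>(\<lambda>t. ln (real t))"
proof (intro conjI allI impI)
  show "(\<lambda>t::nat. ln (real t) / (ln (real t) - ln (real t - 1)) - real t * ln (real t))
           \<in> \<Theta>(\<lambda>t. ln (real t))"
    \<comment> \<open>Since \<open>ln t - ln (t - 1)\<close> is \<open>1 / t + 1 / (2 * t^2)\<close>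
      up to order \<open>1 / t^3\<close>, the quotient is \<open>(t - 1 / 2) * ln t\<close> up to
      lower order, so the difference behaves like \<open>- ln t / 2\<close>.\<close>
    by real_asymp
qed (simp_all add: eta_complete_tensor_power eta_complete_graph)

end
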